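(* Let $f$ be an $n$-variate real polynomial that is nonnegative on the constrained hypercube $\mathcal{H}_{\mathcal{P}}$ with $|\mathcal{P}| = \mathrm{poly}(n)$. Assume that there exists a degree $d$ SONC certificate for $f$. Then there exists a degree $d$ SONC certificate for $f$ involving at most $O\!\left(\binom{n}{\le d}\right)$ many nonnegative circuit polynomials, where $\binom{n}{\le d} = \sum_{k=0}^d \binom{n}{k}$.
   Context: $\mathbb{N}$ contains $0$, $\mathbb{N}^* = \mathbb{N}\setminus\{0\}$, and $[n]=\{1,\dots,n\}$. The condition $|\mathcal{P}|=\mathrm{poly}(n)$ means that the number of constraint polynomials is polynomially bounded in $n$. A circuit polynomial is a polynomial $f(\mathbf{x}) = \sum_{j=0}^r f_{\boldsymbol{\alpha}(j)} \mathbf{x}^{\boldsymbol{\alpha}(j)} + f_{\boldsymbol{\beta}} \mathbf{x}^{\boldsymbol{\beta}}$ in $\mathbb{R}[x_1,\dots,x_n]$ with $r \le n$, exponents $\boldsymbol{\alpha}(j),\boldsymbol{\beta} \in \mathbb{N}^n$, $f_{\boldsymbol{\alpha}(j)} > 0$, $f_{\boldsymbol{\beta}} \in \mathbb{R}$, such that the Newton polytope of $f$ is a simplex with vertices $\boldsymbol{\alpha}(0),\dots,\boldsymbol{\alpha}(r) \in (2\mathbb{N})^n$ and $\boldsymbol{\beta}$ lies in the (relative) interior of this simplex. Monomial squares $c\,\mathbf{x}^{\boldsymbol{\alpha}}$ with $c>0$ and $\boldsymbol{\alpha} \in (2\mathbb{N})^n$ count as nonnegative circuit polynomials. A circuit polynomial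 is nonnegative if it is nonnegative on all of $\mathbb{R}^n$. A SONC polynomial is a finite sum $\sum_i \mu_i q_i$ with $\mu_i \ge 0$ and $q_i$ nonnegative circuit polynomials. Let $a_j<b_j$ be real numbers and $g_j(\mathbf{x}) = (x_j-a_j)(x_j-b_j)$ for $j \in [n]$. For a set $\mathcal{P} = \{p_1,\dots,p_m\} \subset \mathbb{R}[x_1,\dots,x_n]$, $$\mathcal{H}_{\mathcal{P}} = \{\mathbf{x} \in \mathbb{R}^n : g_j(\mathbf{x}) = 0 \text{ for } j \in [n],\ p(\mathbf{x}) \ge 0 \text{ for } p \in \mathcal{P}\}.$$ A degree $d$ SONC certificate for $f$ (on $\mathcal{H}_{\mathcal{P}}$) is a decomposition, for some $q \in \mathbb{N}^*$, $$f(\mathbf{x}) = \sum_{\text{finite}} s(\mathbf{x}) H^{(q)}(\mathbf{x}),$$ where each $s$ is a SONC polynomial, each $H^{(q)}$ is a product of $q$ polynomials from $\{1,\ \pm g_j,\ x_j-a_j,\ b_j-x_j,\ p_i : j\in[n],\ i\in[m]\}$, and $\deg\left(\sum_{\text{finite}} s(\mathbf{x}) H^{(q)}(\mathbf{x})\right) \le d$. *)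

theory Defs
  imports
    "HOL-Analysis.Analysis"
    "HOL-Analysis.Finite_Function_Topology"
    "HOL-Computational_Algebra.Polynomial"
begin

text \<open>
  Exponent vectors are finitely supported functions on the variable indices, and polynomials are
  finitely supported maps from exponent vectors to coefficients; addition and multiplication are
  those of \<open>HOL-Library.Poly_Mapping\<close> (convolution). The ring in the variables
  \<open>x_1, \<dots>, x_n\<close> is cut out by the predicate \<open>poly_ring n\<close>.
\<close>

type_synonym expo = "nat \<Rightarrow>\<^sub>0 nat"
type_synonym mpoly = "(nat \<Rightarrow>\<^sub>0 nat) \<Rightarrow>\<^sub>0 real"

definition expos :: "nat \<Rightarrow> expo set" where
  "expos n = {m. Poly_Mapping.keys m \<subseteq> {1..n}}"

definition poly_ring :: "nat \<Rightarrow> mpoly set" where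
  "poly_ring n = {p. Poly_Mapping.keys p \<subseteq> expos n}"

definition Var :: "nat \<Rightarrow> mpoly" where
  "Var j = Poly_Mapping.single (Poly_Mapping.single j 1) 1"

definition Const :: "real \<Rightarrow> mpoly" where
  "Const c = Poly_Mapping.single 0 c"

text \<open>
  A point of \<open>\<real>^n\<close> is given by a function on indices; for a polynomial in \<open>poly_ring n\<close> only the
  coordinates \<open>1, \<dots>, n\<close> matter.
\<close>

definition peval :: "mpoly \<Rightarrow> (nat \<Rightarrow> real) \<Rightarrow> real" where
  "peval p x = (\<Sum>m\<in>Poly_Mapping.keys p. Poly_Mapping.lookup p m *
     (\<Prod>i\<in>Poly_Mapping.keys m. x i ^ Poly_Mapping.lookup m i))"

definition expo_degree :: "expo \<Rightarrow> nat" where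
  "expo_degree m = (\<Sum>i\<in>Poly_Mapping.keys m. Poly_Mapping.lookup m i)"

text \<open>Total degree; the zero polynomial gets degree \<open>0\<close>.\<close>

definition total_degree :: "mpoly \<Rightarrow> nat" where
  "total_degree p = Max (insert 0 (expo_degree ` Poly_Mapping.keys p))"

text \<open>
  Newton polytopes live in the real normed space of finitely supported functions
  \<open>nat \<Rightarrow>\<^sub>0 real\<close>. On the coordinate subspace \<open>\<real>^n\<close> its topology is the Euclidean one, so that
  \<open>rel_interior\<close> has its usual meaning.
\<close>

definition real_expo :: "expo \<Rightarrow> (nat \<Rightarrow>\<^sub>0 real)" where
  "real_expo m = Poly_Mapping.map real m"

definition newton_polytope :: "mpoly \<Rightarrow> (nat \<Rightarrow>\<^sub>0 real) set" where
  "newton_polytope p = convex hull (real_expo ` Poly_Mapping.keys p)"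

definition even_expo :: "expo \<Rightarrow> bool" where
  "even_expo m \<longleftrightarrow> (\<forall>i. even (Poly_Mapping.lookup m i))"

definition circuit_poly :: "nat \<Rightarrow> mpoly \<Rightarrow> bool" where
  "circuit_poly n f \<longleftrightarrow>
     (\<exists>r (\<alpha> :: nat \<Rightarrow> expo) (\<beta> :: expo) (c :: nat \<Rightarrow> real) (cb :: real).
        r \<le> n \<and>
        (\<forall>j\<in>{0..r}. \<alpha> j \<in> expos n \<and> even_expo (\<alpha> j) \<and> c j > 0) \<and>
        \<beta> \<in> expos n \<and>
        f = (\<Sum>j=0..r. Poly_Mapping.single (\<alpha> j) (c j)) + Poly_Mapping.single \<beta> cb \<and>
        inj_on \<alpha> {0..r} \<and>
        \<not> affine_dependent (real_expo ` \<alpha> ` {0..r}) \<and>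
        newton_polytope f = convex hull (real_expo ` \<alpha> ` {0..r}) \<and>
        real_expo \<beta> \<in> rel_interior (newton_polytope f))"

definition monomial_square :: "nat \<Rightarrow> mpoly \<Rightarrow> bool" where
  "monomial_square n f \<longleftrightarrow>
     (\<exists>m c. m \<in> expos n \<and> even_expo m \<and> c > 0 \<and> f = Poly_Mapping.single m c)"

definition nonneg_circuit :: "nat \<Rightarrow> mpoly \<Rightarrow> bool" where
  "nonneg_circuit n f \<longleftrightarrow>
     monomial_square n f \<or> (circuit_poly n f \<and> (\<forall>x. peval f x \<ge> 0))"

text \<open>
  \<open>sonc_decomp n s ws\<close>: the list \<open>ws\<close> of pairs \<open>(\<mu>, q)\<close> exhibits \<open>s\<close> as a SONC polynomial.
\<close>

definition sonc_decomp :: "nat \<Rightarrow> mpoly \<Rightarrow> (real \<times> mpoly) list \<Rightarrow> bool" where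
  "sonc_decomp n s ws \<longleftrightarrow>
     (\<forall>(\<mu>, q)\<in>set ws. \<mu> \<ge> 0 \<and> nonneg_circuit n q) \<and> s = (\<Sum>(\<mu>, q)\<leftarrow>ws. \<mu> *\<^sub>R q)"

definition sonc :: "nat \<Rightarrow> mpoly \<Rightarrow> bool" where
  "sonc n s \<longleftrightarrow> (\<exists>ws. sonc_decomp n s ws)"

definition cube_poly :: "(nat \<Rightarrow> real) \<Rightarrow> (nat \<Rightarrow> real) \<Rightarrow> nat \<Rightarrow> mpoly" where
  "cube_poly a b j = (Var j - Const (a j)) * (Var j - Const (b j))"

definition constrained_hypercube ::
  "nat \<Rightarrow> (nat \<Rightarrow> real) \<Rightarrow> (nat \<Rightarrow> real) \<Rightarrow> mpoly set \<Rightarrow> (nat \<Rightarrow> real) set" where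
  "constrained_hypercube n a b P =
     {x. (\<forall>j\<in>{1..n}. peval (cube_poly a b j) x = 0) \<and> (\<forall>p\<in>P. peval p x \<ge> 0)}"

definition certificate_factors ::
  "nat \<Rightarrow> (nat \<Rightarrow> real) \<Rightarrow> (nat \<Rightarrow> real) \<Rightarrow> mpoly set \<Rightarrow> mpoly set" where
  "certificate_factors n a b P =
     {1} \<union> cube_poly a b ` {1..n} \<union> (\<lambda>j. - cube_poly a b j) ` {1..n} \<union>
     (\<lambda>j. Var j - Const (a j)) ` {1..n} \<union> (\<lambda>j. Const (b j) - Var j) ` {1..n} \<union> P"

definition factor_products ::
  "nat \<Rightarrow> (nat \<Rightarrow> real) \<Rightarrow> (nat \<Rightarrow> real) \<Rightarrow> mpoly set \<Rightarrow> nat \<Rightarrow> mpoly set" where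
  "factor_products n a b P q =
     {prod_list hs | hs. length hs = q \<and> set hs \<subseteq> certificate_factors n a b P}"

text \<open>
  A certificate is the list of its terms \<open>(s, H)\<close>. Its degree is that of the formal sum, i.e. the
  largest degree of a summand \<open>s * H\<close>: after cancellation the sum is just \<open>f\<close>, so bounding the
  degree of its value would put no condition on the certificate itself.
\<close>

definition sonc_certificate ::
  "nat \<Rightarrow> (nat \<Rightarrow> real) \<Rightarrow> (nat \<Rightarrow> real) \<Rightarrow> mpoly set \<Rightarrow> nat \<Rightarrow> mpoly \<Rightarrow> (mpoly \<times> mpoly) list \<Rightarrow> bool"
  where
  "sonc_certificate n a b P d f L \<longleftrightarrow>
     (\<exists>q\<ge>1. \<forall>(s, H)\<in>set L. sonc n s \<and> H \<in> factor_products n a b P q) \<and>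
     f = (\<Sum>(s, H)\<leftarrow>L. s * H) \<and>
     (\<forall>(s, H)\<in>set L. total_degree (s * H) \<le> d)"

text \<open>
  \<open>W\<close> lists, term by term, a decomposition of each SONC polynomial of the certificate \<open>L\<close> into
  nonnegative circuit polynomials. \<open>circuits W\<close> is the set of circuit polynomials that occur,
  \<open>circuit_occurrences W\<close> counts them with repetition.
\<close>

definition circuit_decomp ::
  "nat \<Rightarrow> (mpoly \<times> mpoly) list \<Rightarrow> (real \<times> mpoly) list list \<Rightarrow> bool" where
  "circuit_decomp n L W \<longleftrightarrow> list_all2 (\<lambda>(s, H) ws. sonc_decomp n s ws) L W"

definition circuits :: "(real \<times> mpoly) list list \<Rightarrow> mpoly set" where
  "circuits W = (\<Union>ws\<in>set W. snd ` set ws)"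

definition circuit_occurrences :: "(real \<times> mpoly) list list \<Rightarrow> nat" where
  "circuit_occurrences W = (\<Sum>ws\<leftarrow>W. length ws)"

definition binomial_upto :: "nat \<Rightarrow> nat \<Rightarrow> nat" where
  "binomial_upto n d = (\<Sum>k=0..d. n choose k)"

end

theory Submission
  imports Defs
begin

text \<open>
  Nonnegative circuit polynomials have positive leading coefficients for the graded lexicographic
  order, so the leading terms in a SONC polynomial \<open>s\<close> do not cancel: each summand \<open>p\<close> of \<open>s\<close>
  satisfies \<open>deg (p H) \<le> deg (s H)\<close>, and \<open>f\<close> lies in the cone of single products \<open>p H\<close> of degree
  at most \<open>d\<close>.

  Since \<open>x\<^sub>j = (x\<^sub>j - a\<^sub>j) + a\<^sub>j\<close> and both \<open>g\<^sub>j\<close> and \<open>- g\<^sub>j\<close> are available as factors, every polynomial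
  \<open>x\<^sup>m g\<^sub>j\<close> with \<open>|m| + 2 \<le> d\<close> has a certificate of degree \<open>d\<close> in which the constant \<open>1\<close> is the only
  circuit. Modulo such polynomials all products \<open>p H\<close> reduce to the span of the squarefree monomials
  of degree at most \<open>d\<close>, whose dimension is \<open>binomial_upto n d\<close>. The conic Caratheodory theorem in that
  space leaves at most that many circuits, besides the constant \<open>1\<close> needed for the difference. A second
  application in the space of all polynomials of degree at most \<open>d\<close> bounds the number of
  occurrences without introducing new circuits.
\<close>

subsection \<open>Leading monomials of circuit polynomials\<close>

abbreviation lookup :: "('a \<Rightarrow>\<^sub>0 'b::zero) \<Rightarrow> 'a \<Rightarrow> 'b" where
  "lookup \<equiv> Poly_Mapping.lookup"

abbreviation keys :: "('a \<Rightarrow>\<^sub>0 'b::zero) \<Rightarrow> 'a set" where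
  "keys \<equiv> Poly_Mapping.keys"

lemma lookup_scaleR [simp]: "lookup (c *\<^sub>R p) k = c *\<^sub>R lookup p k"
  for p :: "'a \<Rightarrow>\<^sub>0 'b::real_vector"
proof -
  have "finite {i. c *\<^sub>R lookup p i \<noteq> 0}"
    by (rule finite_subset[OF _ finite_lookup[of p]]) auto
  then show ?thesis
    by (simp add: scaleR_poly_mapping_def)
qed

lemma lookup_real_expo [simp]: "lookup (real_expo m) i = real (lookup m i)"
  unfolding real_expo_def by transfer (simp add: when_def)

section \<open>Degrees of exponent vectors and polynomials\<close>

lemma expo_degree_superset:
  "finite S \<Longrightarrow> keys m \<subseteq> S \<Longrightarrow> expo_degree m = (\<Sum>i\<in>S. lookup m i)"
  unfolding expo_degree_def by (rule sum.mono_neutral_left) (auto simp: in_keys_iff)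

lemma expo_degree_zero [simp]: "expo_degree 0 = 0"
  by (simp add: expo_degree_def)

lemma expo_degree_add: "expo_degree (m + m') = expo_degree m + expo_degree m'"
proof -
  let ?S = "keys m \<union> keys m'"
  have "keys (m + m') \<subseteq> ?S"
    by (rule keys_add)
  then show ?thesis
    by (simp add: expo_degree_superset[of ?S] lookup_add sum.distrib)
qed

lemma expo_degree_single [simp]: "expo_degree (Poly_Mapping.single j k) = k"
  by (simp add: expo_degree_def)

lemma expo_degree_le_total_degree:
  "m \<in> keys p \<Longrightarrow> expo_degree m \<le> total_degree p"
  by (simp add: total_degree_def)

lemma total_degree_leI:
  "(\<And>m. m \<in> keys p \<Longrightarrow> expo_degree m \<le> d) \<Longrightarrow> total_degree p \<le> d"
  by (auto simp: total_degree_def)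

text \<open>The order \<open>\<le>\<close> on exponent vectors is lexicographic, decided at the
  smallest index where they differ. Degree comes first, so that the largest monomial of a polynomial
  also attains its total degree.\<close>

definition grlex_le :: "expo \<Rightarrow> expo \<Rightarrow> bool" where
  "grlex_le m m' \<longleftrightarrow>
     expo_degree m < expo_degree m' \<or> (expo_degree m = expo_degree m' \<and> m \<le> m')"

lemma grlex_le_refl [simp]: "grlex_le m m"
  by (simp add: grlex_le_def)

lemma grlex_le_degree: "grlex_le m m' \<Longrightarrow> expo_degree m \<le> expo_degree m'"
  by (auto simp: grlex_le_def)

lemma ex_grlex_max:
  assumes "finite M" "M \<noteq> {}"
  obtains m where "m \<in> M" "\<And>m'. m' \<in> M \<Longrightarrow> grlex_le m' m"
proof -
  define D where "D = Max (expo_degree ` M)"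
  define M' where "M' = {m \<in> M. expo_degree m = D}"
  have le: "expo_degree m \<le> D" if "m \<in> M" for m
    using that assms by (simp add: D_def)
  have "D \<in> expo_degree ` M"
    unfolding D_def using assms by (intro Max_in) auto
  then have "M' \<noteq> {}" "finite M'"
    using assms by (auto simp: M'_def)
  then have "Max M' \<in> M'" "\<And>m. m \<in> M' \<Longrightarrow> m \<le> Max M'"
    by (auto intro: Max_in)
  then show thesis
    using le by (intro that[of "Max M'"]) (force simp: M'_def grlex_le_def)+
qed

text \<open>Both sides have the same total degree, so neither comparison is strict in degree. Both
  are then lexicographic, and that order is strictly compatible with addition.\<close>

lemma grlex_add_eqD:
  assumes "grlex_le l m" "grlex_le k h" "m + h = l + k"
  shows "l = m" "k = h"
proof -
  have "expo_degree m + expo_degree h = expo_degree l + expo_degree k"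
    using assms(3) by (metis expo_degree_add)
  then have le: "l \<le> m" "k \<le> h"
    using assms(1,2) by (auto simp: grlex_le_def)
  show "l = m"
  proof (rule ccontr)
    assume "l \<noteq> m"
    then have "l + k < m + h"
      using le by (intro add_less_le_mono) auto
    then show False
      using assms(3) by simp
  qed
  then show "k = h"
    using assms(3) by simp
qed

text \<open>By \<open>grlex_add_eqD\<close>, only the pair \<open>m\<close>, \<open>h\<close>
  contributes to the convolution at \<open>m + h\<close>.\<close>

lemma lookup_mult_grlex_max:
  assumes m: "\<And>l. l \<in> keys p \<Longrightarrow> grlex_le l m"
    and h: "\<And>k. k \<in> keys q \<Longrightarrow> grlex_le k h"
  shows "lookup (p * q) (m + h) = lookup p m * lookup (q :: mpoly) h"
proof -
  have "lookup p l * (\<Sum>k. lookup q k when m + h = l + k) =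
      (lookup p l * lookup q h when l = m)" for l
  proof (cases "l \<in> keys p")
    case True
    then have "(lookup q k when m + h = l + k) = ((lookup q h when l = m) when k = h)" for k
      using grlex_add_eqD[OF m h, of l k] by (auto simp: when_def in_keys_iff)
    then show ?thesis
      by (simp add: mult_when)
  qed (simp add: in_keys_iff)
  then show ?thesis
    by (simp add: lookup_mult)
qed

lemma total_degree_mult_le: "total_degree (p * q) \<le> total_degree p + total_degree q"
proof (rule total_degree_leI)
  fix m assume "m \<in> keys (p * q)"
  then obtain k l where "m = k + l" "k \<in> keys p" "l \<in> keys q"
    using keys_mult by blast
  then show "expo_degree m \<le> total_degree p + total_degree q"
    by (simp add: expo_degree_add add_mono expo_degree_le_total_degree)
qed

text \<open>The segment from \<open>v\<close> to a relative interior point \<open>x\<close> can be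
  prolonged a little inside the hull. If \<open>\<phi> v\<close> were below the maximum
  \<open>\<phi> x\<close>, then \<open>\<phi>\<close> would exceed this maximum beyond
  \<open>x\<close>.\<close>

lemma rel_interior_hull_linear_max:
  fixes \<phi> :: "'a::real_normed_vector \<Rightarrow> real"
  assumes x: "x \<in> rel_interior (convex hull A)" and "linear \<phi>"
    and le: "\<And>v. v \<in> A \<Longrightarrow> \<phi> v \<le> \<phi> x" and "v \<in> A"
  shows "\<phi> v = \<phi> x"
proof -
  let ?S = "convex hull A"
  interpret linear \<phi> by fact
  have "convex {v. \<phi> v \<le> \<phi> x}"
  proof (rule convexI)
    fix y z s t
    assume "y \<in> {v. \<phi> v \<le> \<phi> x}" "z \<in> {v. \<phi> v \<le> \<phi> x}" "0 \<le> s" "0 \<le> t" "s + t = (1::real)"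
    then have "s * \<phi> y + t * \<phi> z \<le> \<phi> x"
      by (intro convex_bound_le) auto
    then show "s *\<^sub>R y + t *\<^sub>R z \<in> {v. \<phi> v \<le> \<phi> x}"
      by (simp add: add scale)
  qed
  then have hull_le: "?S \<subseteq> {v. \<phi> v \<le> \<phi> x}"
    using le by (intro hull_minimal) auto
  obtain e where e: "e > 0" "ball x e \<inter> affine hull ?S \<subseteq> ?S" and xS: "x \<in> ?S"
    using x by (auto simp: mem_rel_interior_ball)
  have vS: "v \<in> ?S"
    using \<open>v \<in> A\<close> by (simp add: hull_inc)
  \<comment> \<open>\<open>y\<close> will lie beyond \<open>x\<close> on the ray from
    \<open>v\<close>, at distance less than \<open>e\<close> from \<open>x\<close>; the
    \<open>+ 1\<close> keeps the denominator positive when \<open>v = x\<close>.\<close>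
  define \<delta> where "\<delta> = e / (2 * (norm (x - v) + 1))"
  define y where "y = (1 + \<delta>) *\<^sub>R x + (- \<delta>) *\<^sub>R v"
  have "\<delta> > 0"
    using \<open>e > 0\<close> by (auto simp: \<delta>_def intro!: divide_pos_pos add_nonneg_pos)
  have "y - x = \<delta> *\<^sub>R (x - v)"
    by (simp add: y_def algebra_simps)
  then have "norm (y - x) = \<delta> * norm (x - v)"
    using \<open>\<delta> > 0\<close> by simp
  also have "\<dots> < e"
  proof -
    define N where "N = norm (x - v)"
    have "N \<ge> 0"
      by (simp add: N_def)
    then have "e = \<delta> * (2 * (N + 1))"
      by (simp add: \<delta>_def N_def [symmetric])
    also have "\<dots> > \<delta> * N"
      using \<open>\<delta> > 0\<close> \<open>N \<ge> 0\<close> by (intro mult_strict_left_mono) auto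
    finally have "\<delta> * N < e" .
    then show ?thesis
      by (simp add: N_def)
  qed
  finally have "y \<in> ball x e"
    by (simp add: dist_norm norm_minus_commute)
  moreover have "y \<in> affine hull ?S"
    unfolding y_def
    by (rule mem_affine[OF affine_affine_hull hull_inc[OF xS] hull_inc[OF vS]]) simp
  ultimately have "\<phi> y \<le> \<phi> x"
    using e(2) hull_le by blast
  then have "\<delta> * (\<phi> x - \<phi> v) \<le> 0"
    by (simp add: y_def add scale diff algebra_simps)
  then have "\<phi> x \<le> \<phi> v"
    using \<open>\<delta> > 0\<close> by (simp add: mult_le_0_iff)
  then show ?thesis
    using le[OF \<open>v \<in> A\<close>] by simp
qed

text \<open>The graded lexicographic order is not a single linear functional, so
  \<open>rel_interior_hull_linear_max\<close> is applied first to the degree and then to the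
  coordinates in turn. Each of them is constant on \<open>M\<close>.\<close>

lemma grlex_max_rel_interior:
  assumes \<beta>: "real_expo \<beta> \<in> rel_interior (convex hull (real_expo ` M))" and "finite M"
    and max: "\<And>m. m \<in> M \<Longrightarrow> grlex_le m \<beta>" and "m \<in> M"
  shows "m = \<beta>"
proof -
  \<comment> \<open>On vectors supported in the finite set \<open>S\<close> the degree is linear: it
    is the sum of the coordinates in \<open>S\<close>.\<close>
  define S where "S = keys \<beta> \<union> (\<Union>m\<in>M. keys m)"
  have S: "finite S" "keys \<beta> \<subseteq> S" "\<And>m. m \<in> M \<Longrightarrow> keys m \<subseteq> S"
    using \<open>finite M\<close> by (auto simp: S_def)
  have coord: "linear (\<lambda>v :: nat \<Rightarrow>\<^sub>0 real. lookup v i)" for i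
    by (rule linearI) (simp_all add: lookup_add)
  have deg: "(\<Sum>i\<in>S. lookup (real_expo m) i) = real (expo_degree m)" if "m \<in> insert \<beta> M" for m
    using that S expo_degree_superset[of S m] by auto
  have deg_eq: "expo_degree m = expo_degree \<beta>" if "m \<in> M" for m
  proof -
    have "(\<Sum>i\<in>S. lookup (real_expo m) i) = (\<Sum>i\<in>S. lookup (real_expo \<beta>) i)"
      using that deg max grlex_le_degree
      by (intro rel_interior_hull_linear_max[OF \<beta>, of "\<lambda>v. \<Sum>i\<in>S. lookup v i"]
          linear_compose_sum) (auto simp: coord simp del: lookup_real_expo)
    then show ?thesis
      using deg that by simp
  qed
  \<comment> \<open>Once the degrees and all earlier coordinates agree, the lexicographic comparison
    makes coordinate \<open>i\<close> maximal at \<beta>.\<close>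
  have "\<forall>m\<in>M. lookup m i = lookup \<beta> i" for i
  proof (induction i rule: less_induct)
    case (less i)
    have "lookup m i \<le> lookup \<beta> i" if "m \<in> M" for m
    proof -
      have "m \<le> \<beta>"
        using max[OF that] deg_eq[OF that] by (simp add: grlex_le_def)
      then consider "m = \<beta>" | k where "lookup m k < lookup \<beta> k" "\<forall>k'<k. lookup m k' = lookup \<beta> k'"
        by (auto simp: less_eq_poly_mapping.rep_eq less_fun_def lookup_inject)
      then show ?thesis
      proof cases
        case 2
        then have "i \<le> k"
          using less that by (metis leI less_irrefl)
        then show ?thesis
          using 2 by (cases "i = k") auto
      qed simp
    qed
    then have "lookup (real_expo m) i = lookup (real_expo \<beta>) i" if "m \<in> M" for m
      using that by (intro rel_interior_hull_linear_max[OF \<beta> coord[of i]]) auto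
    then show ?case
      by simp
  qed
  then show ?thesis
    using \<open>m \<in> M\<close> by (intro poly_mapping_eqI) auto
qed

text \<open>Away from \<beta> every coefficient is a sum of positive numbers. If \<beta> leads, it
  dominates all vertices while lying in the relative interior of their hull; then all vertices equal
  \<beta>, and \<open>q\<close> is a single monomial whose sign is visible at one point.\<close>

lemma nonneg_circuit_lead_coeff_pos:
  assumes q: "nonneg_circuit n q" and m: "m \<in> keys q"
    and max: "\<And>l. l \<in> keys q \<Longrightarrow> grlex_le l m"
  shows "lookup q m > 0"
proof (cases "monomial_square n q")
  case True
  then show ?thesis
    using m by (auto simp: monomial_square_def split: if_splits)
next
  case False
  then have nonneg: "peval q x \<ge> 0" and "circuit_poly n q" for x
    using q by (auto simp: nonneg_circuit_def)
  then obtain r :: nat and \<alpha> \<beta> c cb where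
      \<alpha>: "\<forall>j\<in>{0..r}. \<alpha> j \<in> expos n \<and> even_expo (\<alpha> j) \<and> c j > 0"
    and qeq: "q = (\<Sum>j=0..r. Poly_Mapping.single (\<alpha> j) (c j)) + Poly_Mapping.single \<beta> cb"
    and hull: "newton_polytope q = convex hull (real_expo ` \<alpha> ` {0..r})"
    and "real_expo \<beta> \<in> rel_interior (newton_polytope q)"
    unfolding circuit_poly_def by blast
  then have ri: "real_expo \<beta> \<in> rel_interior (convex hull (real_expo ` \<alpha> ` {0..r}))"
    by simp
  have c: "c j > 0" if "j \<in> {0..r}" for j
    using \<alpha> that by blast
  have look: "lookup q k = (\<Sum>j=0..r. (c j when \<alpha> j = k)) + (cb when \<beta> = k)" for k
    by (simp add: qeq lookup_add lookup_sum lookup_single)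
  show ?thesis
  proof (cases "m = \<beta>")
    case False
    have "lookup q m = (\<Sum>j=0..r. (c j when \<alpha> j = m))"
      using False by (simp add: look)
    moreover have "\<dots> \<ge> 0"
      using c by (intro sum_nonneg) (auto simp: when_def less_imp_le)
    moreover have "lookup q m \<noteq> 0"
      using m by (simp add: in_keys_iff)
    ultimately show ?thesis
      by simp
  next
    case True
    \<comment> \<open>The inner term cannot cancel a vertex other than \<beta>, so such a vertex
      occurs in \<open>q\<close> and \<open>max\<close> applies to it.\<close>
    have "grlex_le (\<alpha> j) \<beta>" if "j \<in> {0..r}" for j
    proof (cases "\<alpha> j = \<beta>")
      case False
      have "0 < (c j when \<alpha> j = \<alpha> j)"
        using c[OF that] by simp
      also have "\<dots> \<le> (\<Sum>i=0..r. (c i when \<alpha> i = \<alpha> j))"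
        using that c by (intro member_le_sum) (auto simp: when_def less_imp_le)
      also have "\<dots> = lookup q (\<alpha> j)"
        using False by (simp add: look)
      finally show ?thesis
        using max True by (simp add: in_keys_iff)
    qed simp
    then have "\<alpha> j = \<beta>" if "j \<in> {0..r}" for j
      using that by (intro grlex_max_rel_interior[OF ri]) auto
    then have "q = Poly_Mapping.single \<beta> (lookup q \<beta>)"
      by (intro poly_mapping_eqI) (auto simp: look lookup_single when_def)
    then obtain C where C: "q = Poly_Mapping.single \<beta> C"
      by blast
    then have "C \<noteq> 0"
      using m True by auto
    \<comment> \<open>Every monomial has the value 1 at the point with all coordinates 1.\<close>
    then have "peval q (\<lambda>_. 1) = C"
      by (simp add: C peval_def)
    then show ?thesis
      using nonneg[of "\<lambda>_. 1"] True \<open>C \<noteq> 0\<close> by (simp add: C)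
  qed
qed

text \<open>At the largest monomial \<open>m\<close> occurring in any \<open>q i\<close>, the
  nonzero coefficients are all positive, so the weighted sum keeps \<open>m\<close>. With the
  leading monomial \<open>h\<close> of \<open>H\<close>, the monomial \<open>m + h\<close> survives
  in the product and bounds the degree from below.\<close>

lemma total_degree_circuit_mult_le:
  assumes "finite A" and \<mu>: "\<And>i. i \<in> A \<Longrightarrow> \<mu> i > 0"
    and q: "\<And>i. i \<in> A \<Longrightarrow> nonneg_circuit n (q i)"
    and "H \<noteq> 0" "j \<in> A"
  shows "total_degree (q j * H) \<le> total_degree ((\<Sum>i\<in>A. \<mu> i *\<^sub>R q i) * H)"
proof (cases "q j = 0")
  case False
  let ?s = "\<Sum>i\<in>A. \<mu> i *\<^sub>R q i"
  define M where "M = (\<Union>i\<in>A. keys (q i))"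
  have look: "lookup ?s k = (\<Sum>i\<in>A. \<mu> i * lookup (q i) k)" for k
    by (simp add: lookup_sum)
  have "finite M" "M \<noteq> {}"
    using False \<open>finite A\<close> \<open>j \<in> A\<close> by (auto simp: M_def)
  then obtain m where m: "m \<in> M" "\<And>l. l \<in> M \<Longrightarrow> grlex_le l m"
    by (rule ex_grlex_max) blast
  have "finite (keys H)" "keys H \<noteq> {}"
    using \<open>H \<noteq> 0\<close> by (auto simp: keys_eq_empty)
  then obtain h where h: "h \<in> keys H" "\<And>l. l \<in> keys H \<Longrightarrow> grlex_le l h"
    by (rule ex_grlex_max) blast
  \<comment> \<open>\<open>m\<close> dominates all supports, hence leads every \<open>q i\<close> in
    which it occurs.\<close>
  have pos: "lookup (q i) m > 0" if "i \<in> A" "m \<in> keys (q i)" for i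
    using that q m by (intro nonneg_circuit_lead_coeff_pos[of n]) (auto simp: M_def)
  obtain i where i: "i \<in> A" "m \<in> keys (q i)"
    using m(1) by (auto simp: M_def)
  have "0 < \<mu> i * lookup (q i) m"
    using i pos \<mu> by simp
  also have "\<dots> \<le> lookup ?s m"
  proof -
    have "0 \<le> \<mu> k * lookup (q k) m" if "k \<in> A" for k
      using pos[of k] \<mu>[of k] that
      by (cases "m \<in> keys (q k)") (auto simp: in_keys_iff intro!: mult_nonneg_nonneg less_imp_le)
    then show ?thesis
      unfolding look using i(1) \<open>finite A\<close> by (intro member_le_sum) auto
  qed
  finally have sm: "lookup ?s m > 0" .
  have "keys ?s \<subseteq> M"
    by (force simp: in_keys_iff look M_def intro: sum.neutral)
  then have "lookup (?s * H) (m + h) = lookup ?s m * lookup H h"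
    using m h by (intro lookup_mult_grlex_max) auto
  then have "m + h \<in> keys (?s * H)"
    using sm h(1) by (simp add: in_keys_iff)
  then have "expo_degree m + expo_degree h \<le> total_degree (?s * H)"
    by (metis expo_degree_add expo_degree_le_total_degree)
  moreover have "total_degree (q j) \<le> expo_degree m"
    using m(2) \<open>j \<in> A\<close> by (intro total_degree_leI) (auto simp: M_def intro!: grlex_le_degree)
  moreover have "total_degree H \<le> expo_degree h"
    using h(2) by (intro total_degree_leI) (auto intro!: grlex_le_degree)
  ultimately show ?thesis
    using total_degree_mult_le[of "q j" H] by linarith
qed (simp add: total_degree_def)

subsection \<open>Conic combinations\<close>

text \<open>An independent set in \<open>span B\<close> has at most \<open>card B\<close> elements.
  The family may repeat vectors; a repetition gives a relation with coefficients \<open>1\<close>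
  and \<open>-1\<close>.\<close>

lemma linear_relation_if_card_gt:
  fixes w :: "'i \<Rightarrow> 'a::real_vector"
  assumes "finite A" "finite B" and w: "\<And>i. i \<in> A \<Longrightarrow> w i \<in> span B" and "card B < card A"
  obtains c where "\<exists>i\<in>A. c i \<noteq> (0::real)" "(\<Sum>i\<in>A. c i *\<^sub>R w i) = 0"
proof (cases "inj_on w A")
  case True
  have "dependent (w ` A)"
  proof (rule ccontr)
    assume "independent (w ` A)"
    then have "card (w ` A) \<le> card B"
      using independent_span_bound[of B "w ` A"] \<open>finite B\<close> w by blast
    then show False
      using \<open>card B < card A\<close> True by (simp add: card_image)
  qed
  then obtain u where "\<exists>v\<in>w ` A. u v \<noteq> 0" "(\<Sum>v\<in>w ` A. u v *\<^sub>R v) = 0"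
    using \<open>finite A\<close> by (auto simp: dependent_finite)
  then show thesis
    using True by (intro that[of "u \<circ> w"]) (auto simp: sum.reindex)
next
  case False
  then obtain i j where ij: "i \<in> A" "j \<in> A" "i \<noteq> j" "w i = w j"
    by (auto simp: inj_on_def)
  define c where "c = (\<lambda>k. if k = i then 1 else if k = j then -1 else (0::real))"
  have "(\<Sum>k\<in>A. c k *\<^sub>R w k) = (\<Sum>k\<in>{i, j}. c k *\<^sub>R w k)"
    using ij \<open>finite A\<close> by (intro sum.mono_neutral_right) (auto simp: c_def)
  also have "\<dots> = 0"
    using ij by (simp add: c_def)
  finally show thesis
    using ij by (intro that[of c]) (auto simp: c_def)
qed

text \<open>While more than \<open>card B\<close> vectors are in use, the weights are moved along a
  linear relation until one vanishes. Selecting indices instead of vectors allows a choice made for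
  the images \<open>w i\<close> to be carried back to the objects that index them.\<close>

lemma conic_caratheodory:
  fixes w :: "'i \<Rightarrow> 'a::real_vector"
  assumes "finite A" "finite B" and w: "\<And>i. i \<in> A \<Longrightarrow> w i \<in> span B"
    and u: "\<And>i. i \<in> A \<Longrightarrow> u i \<ge> (0::real)"
  obtains A' v where "A' \<subseteq> A" "card A' \<le> card B" "\<And>i. i \<in> A' \<Longrightarrow> v i > 0"
    "(\<Sum>i\<in>A'. v i *\<^sub>R w i) = (\<Sum>i\<in>A. u i *\<^sub>R w i)"
proof -
  have "\<exists>A' v. A' \<subseteq> A \<and> card A' \<le> card B \<and> (\<forall>i\<in>A'. v i > (0::real)) \<and>
      (\<Sum>i\<in>A'. v i *\<^sub>R w i) = (\<Sum>i\<in>A. u i *\<^sub>R w i)"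
    using \<open>finite A\<close> w u
  proof (induction "card A" arbitrary: A u rule: less_induct)
    case (less A)
    \<comment> \<open>An index of weight zero is discarded, and the induction hypothesis applies to
      the rest.\<close>
    have drop: ?case if i: "i \<in> A" "u' i = 0" and u': "\<And>j. j \<in> A \<Longrightarrow> u' j \<ge> 0"
      and eq: "(\<Sum>i\<in>A. u' i *\<^sub>R w i) = (\<Sum>i\<in>A. u i *\<^sub>R w i)" for i u'
    proof -
      have "card (A - {i}) < card A"
        using i(1) less.prems(1) by (intro psubset_card_mono) auto
      then obtain A' v where A': "A' \<subseteq> A - {i}" "card A' \<le> card B" "\<forall>i\<in>A'. v i > (0::real)"
          "(\<Sum>i\<in>A'. v i *\<^sub>R w i) = (\<Sum>i\<in>A - {i}. u' i *\<^sub>R w i)"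
        using less.hyps[of "A - {i}" u'] less.prems u' by auto
      moreover have "(\<Sum>i\<in>A - {i}. u' i *\<^sub>R w i) = (\<Sum>i\<in>A. u' i *\<^sub>R w i)"
        using i less.prems(1) by (simp add: sum_diff1)
      ultimately show ?thesis
        using eq by (metis Diff_subset subset_trans)
    qed
    show ?case
    \<comment> \<open>Zero weights are removed even from a small index set, because the resulting
      weights have to be positive.\<close>
    proof (cases "card A \<le> card B \<or> (\<exists>i\<in>A. u i = 0)")
      case True
      then show ?thesis
      proof
        assume *: "card A \<le> card B"
        show ?thesis
        proof (cases "\<exists>i\<in>A. u i = 0")
          case False
          then have "\<forall>i\<in>A. u i > 0"
            using less.prems(3) by force
          then show ?thesis
            using * by blast
        qed (use drop less.prems(3) in blast)
      qed (use drop less.prems(3) in blast)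
    next
      case False
      then have pos: "u i > 0" if "i \<in> A" for i
        using that less.prems(3) by force
      obtain c0 where c0: "\<exists>i\<in>A. c0 i \<noteq> (0::real)" "(\<Sum>i\<in>A. c0 i *\<^sub>R w i) = 0"
        by (rule linear_relation_if_card_gt[of A B w]) (use less.prems False \<open>finite B\<close> in auto)
      \<comment> \<open>Negating the relation if necessary gives a positive coefficient, which
        limits the step length.\<close>
      obtain c where c: "\<exists>i\<in>A. c i > (0::real)" "(\<Sum>i\<in>A. c i *\<^sub>R w i) = 0"
      proof (cases "\<exists>i\<in>A. c0 i > 0")
        case False
        then have "\<exists>i\<in>A. - c0 i > 0"
          using c0(1) by force
        then show thesis
          using c0(2) by (intro that[of "\<lambda>i. - c0 i"]) (auto simp: sum_negf)
      qed (use c0 that in blast)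
      define R where "R = {i \<in> A. c i > 0}"
      have R: "finite R" "R \<noteq> {}"
        using c(1) less.prems(1) by (auto simp: R_def)
      \<comment> \<open>The longest step along \<open>- c\<close> that keeps all weights
        nonnegative; an index attaining the minimum ends with weight zero.\<close>
      define t where "t = Min ((\<lambda>i. u i / c i) ` R)"
      have "t \<in> (\<lambda>i. u i / c i) ` R"
        unfolding t_def using R by (intro Min_in) auto
      then obtain i where i: "i \<in> R" "t = u i / c i"
        by blast
      have "t \<ge> 0"
        using i pos by (auto simp: R_def intro!: divide_nonneg_pos less_imp_le)
      have t: "t \<le> u j / c j" if "j \<in> R" for j
        unfolding t_def using R that by (intro Min_le) auto
      have "u j - t * c j \<ge> 0" if "j \<in> A" for j
      proof (cases "c j > 0")
        case True
        then show ?thesis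
          using t[of j] that by (simp add: R_def pos_le_divide_eq)
      next
        case False
        then show ?thesis
          using \<open>t \<ge> 0\<close> pos[OF that] mult_nonneg_nonpos[of t "c j"] by linarith
      qed
      moreover have "(\<Sum>j\<in>A. (u j - t * c j) *\<^sub>R w j) = (\<Sum>j\<in>A. u j *\<^sub>R w j)"
      proof -
        have "(\<Sum>j\<in>A. (u j - t * c j) *\<^sub>R w j) =
            (\<Sum>j\<in>A. u j *\<^sub>R w j) - t *\<^sub>R (\<Sum>j\<in>A. c j *\<^sub>R w j)"
          by (simp add: scaleR_left_diff_distrib sum_subtractf scaleR_sum_right)
        then show ?thesis
          by (simp add: c(2))
      qed
      moreover have "i \<in> A" "u i - t * c i = 0"
        using i by (auto simp: R_def)
      ultimately show ?thesis
        by (intro drop[of i "\<lambda>j. u j - t * c j"])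
    qed
  qed
  then obtain A' v where "A' \<subseteq> A \<and> card A' \<le> card B \<and> (\<forall>i\<in>A'. v i > 0) \<and>
      (\<Sum>i\<in>A'. v i *\<^sub>R w i) = (\<Sum>i\<in>A. u i *\<^sub>R w i)"
    by blast
  then show thesis
    by (intro that[of A' v]) auto
qed

text \<open>The finite nonnegative combinations of \<open>S\<close> form a convex cone containing
  \<open>S\<close>, so the hull lies inside it.\<close>

lemma convex_cone_hull_finite_sum:
  assumes "x \<in> convex_cone hull S"
  obtains F u where "finite F" "F \<subseteq> S" "\<And>v. v \<in> F \<Longrightarrow> u v \<ge> (0::real)" "x = (\<Sum>v\<in>F. u v *\<^sub>R v)"
proof -
  define C where "C = {x. \<exists>F u. finite F \<and> F \<subseteq> S \<and> (\<forall>v\<in>F. u v \<ge> (0::real)) \<and> x = (\<Sum>v\<in>F. u v *\<^sub>R v)}"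
  have "convex_cone C"
    unfolding convex_cone_iff
  proof (intro conjI ballI allI impI)
    show "0 \<in> C"
      unfolding C_def by (intro CollectI exI[of _ "{}"]) simp
  next
    fix x y assume "x \<in> C" "y \<in> C"
    then obtain F u G v where FG: "finite F" "F \<subseteq> S" "\<forall>v\<in>F. u v \<ge> (0::real)" "x = (\<Sum>v\<in>F. u v *\<^sub>R v)"
        "finite G" "G \<subseteq> S" "\<forall>w\<in>G. v w \<ge> (0::real)" "y = (\<Sum>w\<in>G. v w *\<^sub>R w)"
      unfolding C_def by blast
    \<comment> \<open>Both weight functions are extended by zero to \<open>F \<union> G\<close>
      before they are added.\<close>
    define c where "c = (\<lambda>w. (if w \<in> F then u w else 0) + (if w \<in> G then v w else 0))"
    have "x = (\<Sum>w\<in>F \<union> G. (if w \<in> F then u w else 0) *\<^sub>R w)"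
      unfolding FG(4) using FG(1,5) by (intro sum.mono_neutral_cong_left) auto
    moreover have "y = (\<Sum>w\<in>F \<union> G. (if w \<in> G then v w else 0) *\<^sub>R w)"
      unfolding FG(8) using FG(1,5) by (intro sum.mono_neutral_cong_left) auto
    ultimately have "x + y = (\<Sum>w\<in>F \<union> G. c w *\<^sub>R w)"
      by (simp add: c_def scaleR_left_distrib sum.distrib)
    then show "x + y \<in> C"
      unfolding C_def using FG by (intro CollectI exI[of _ "F \<union> G"] exI[of _ c]) (auto simp: c_def)
  next
    fix x and t :: real assume "x \<in> C" "t \<ge> 0"
    then obtain F u where F: "finite F" "F \<subseteq> S" "\<forall>v\<in>F. u v \<ge> (0::real)" "x = (\<Sum>v\<in>F. u v *\<^sub>R v)"
      unfolding C_def by blast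
    then show "t *\<^sub>R x \<in> C"
      unfolding C_def using \<open>t \<ge> 0\<close>
      by (intro CollectI exI[of _ F] exI[of _ "\<lambda>v. t * u v"]) (auto simp: scaleR_sum_right)
  qed
  moreover have "S \<subseteq> C"
    unfolding C_def by (intro subsetI CollectI exI[of _ "{_}"] exI[of _ "\<lambda>_. 1"]) auto
  ultimately have "convex_cone hull S \<subseteq> C"
    by (intro hull_minimal)
  then show thesis
    using assms that unfolding C_def by blast
qed

lemma convex_cone_hull_sum:
  assumes "\<And>i. i \<in> A \<Longrightarrow> u i \<ge> 0 \<and> x i \<in> convex_cone hull S"
  shows "(\<Sum>i\<in>A. u i *\<^sub>R x i) \<in> convex_cone hull S"
  using assms
  by (induction A rule: infinite_finite_induct)
     (auto intro: convex_cone_hull_add convex_cone_hull_mul simp: convex_cone_hull_contains_0)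

subsection \<open>Counting monomials\<close>

definition monomials_upto :: "nat \<Rightarrow> nat \<Rightarrow> expo set" where
  "monomials_upto n d = {m \<in> expos n. expo_degree m \<le> d}"

text \<open>The multilinear monomials, which correspond to sets of at most \<open>d\<close>
  variables, serve as normal forms modulo the cube polynomials.\<close>

definition squarefree_upto :: "nat \<Rightarrow> nat \<Rightarrow> expo set" where
  "squarefree_upto n d = {m \<in> monomials_upto n d. \<forall>i. lookup m i \<le> 1}"

lemma lookup_le_expo_degree: "lookup m i \<le> expo_degree m"
proof (cases "i \<in> keys m")
  case True
  then show ?thesis
    unfolding expo_degree_def by (intro member_le_sum) auto
qed (simp add: in_keys_iff)

lemma card_keys_le_expo_degree: "card (keys m) \<le> expo_degree m"
proof -
  have "(\<Sum>i\<in>keys m. 1) \<le> (\<Sum>i\<in>keys m. lookup m i)"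
    by (rule sum_mono) (simp add: in_keys_iff Suc_leI)
  then show ?thesis
    by (simp add: expo_degree_def)
qed

lemma card_small_subsets: "card {S. S \<subseteq> {1..n} \<and> card S \<le> d} = binomial_upto n d"
proof -
  have eq: "{S. S \<subseteq> {1..n} \<and> card S \<le> d} = (\<Union>k\<in>{0..d}. {S. S \<subseteq> {1..n} \<and> card S = k})"
    by auto
  have "card (\<Union>k\<in>{0..d}. {S. S \<subseteq> {1..n} \<and> card S = k}) =
      (\<Sum>k=0..d. card {S. S \<subseteq> {1..n} \<and> card S = k})"
    by (rule card_UN_disjoint) auto
  also have "\<dots> = binomial_upto n d"
    by (simp add: n_subsets binomial_upto_def)
  finally show ?thesis
    by (simp only: eq)
qed

lemma keys_monomials_upto:
  "m \<in> monomials_upto n d \<Longrightarrow> keys m \<in> {S. S \<subseteq> {1..n} \<and> card S \<le> d}"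
  using card_keys_le_expo_degree[of m] by (auto simp: monomials_upto_def expos_def)

lemma finite_small_subsets: "finite {S. S \<subseteq> {1..n::nat} \<and> card S \<le> d}"
  by (rule finite_subset[of _ "Pow {1..n}"]) auto

text \<open>The support is a set of at most \<open>d\<close> variables, and each such set carries at
  most \<open>(d + 1) ^ d\<close> exponent patterns, since every exponent is at most
  \<open>d\<close>.\<close>

lemma card_monomials_upto:
  "finite (monomials_upto n d)" "card (monomials_upto n d) \<le> (d + 1) ^ d * binomial_upto n d"
proof -
  let ?X = "{S. S \<subseteq> {1..n} \<and> card S \<le> d}"
  let ?E = "\<lambda>S. {m :: expo. keys m = S \<and> (\<forall>i. lookup m i \<le> d)}"
  have fin: "finite (?E S)" and card: "card (?E S) \<le> (d + 1) ^ d" if "S \<in> ?X" for S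
  proof -
    have "finite S" "card S \<le> d"
      using that finite_subset by auto
    have inj: "inj_on (\<lambda>m. restrict (lookup m) S) (?E S)"
    proof (rule inj_onI, rule poly_mapping_eqI)
      fix m m' i assume *: "m \<in> ?E S" "m' \<in> ?E S" "restrict (lookup m) S = restrict (lookup m') S"
      show "lookup m i = lookup m' i"
      proof (cases "i \<in> S")
        case True
        then show ?thesis
          using fun_cong[OF *(3), of i] by simp
      next
        case False
        then have "i \<notin> keys m" "i \<notin> keys m'"
          using * by auto
        then show ?thesis
          by (simp add: in_keys_iff)
      qed
    qed
    have sub: "(\<lambda>m. restrict (lookup m) S) ` ?E S \<subseteq> (\<Pi>\<^sub>E i\<in>S. {0..d})"
      by auto
    have finE: "finite (\<Pi>\<^sub>E i\<in>S. {0..d})"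
      using \<open>finite S\<close> by (intro finite_PiE) auto
    show "finite (?E S)"
      by (rule inj_on_finite[OF inj sub finE])
    have "card (?E S) \<le> card (\<Pi>\<^sub>E i\<in>S. {0..d})"
      by (rule card_inj_on_le[OF inj sub finE])
    also have "\<dots> = (d + 1) ^ card S"
      using \<open>finite S\<close> by (simp add: card_PiE)
    also have "\<dots> \<le> (d + 1) ^ d"
      using \<open>card S \<le> d\<close> by (intro power_increasing) auto
    finally show "card (?E S) \<le> (d + 1) ^ d" .
  qed
  have sub: "monomials_upto n d \<subseteq> (\<Union>S\<in>?X. ?E S)"
  proof
    fix m assume m: "m \<in> monomials_upto n d"
    then have "lookup m i \<le> d" for i
      using lookup_le_expo_degree[of m i] by (simp add: monomials_upto_def)
    then show "m \<in> (\<Union>S\<in>?X. ?E S)"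
      using keys_monomials_upto[OF m] by auto
  qed
  have finU: "finite (\<Union>S\<in>?X. ?E S)"
    by (rule finite_UN_I[OF finite_small_subsets fin])
  then show "finite (monomials_upto n d)"
    using sub finite_subset by blast
  have "card (monomials_upto n d) \<le> card (\<Union>S\<in>?X. ?E S)"
    by (rule card_mono[OF finU sub])
  also have "\<dots> \<le> (\<Sum>S\<in>?X. card (?E S))"
    by (rule card_UN_le[OF finite_small_subsets])
  also have "\<dots> \<le> (\<Sum>S\<in>?X. (d + 1) ^ d)"
    by (rule sum_mono) (use card in blast)
  also have "\<dots> = (d + 1) ^ d * binomial_upto n d"
    by (simp only: sum_constant card_small_subsets of_nat_id mult.commute)
  finally show "card (monomials_upto n d) \<le> (d + 1) ^ d * binomial_upto n d" .
qed

text \<open>A squarefree monomial is determined by its support.\<close>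

lemma card_squarefree_upto:
  "finite (squarefree_upto n d)" "card (squarefree_upto n d) \<le> binomial_upto n d"
proof -
  have inj: "inj_on keys (squarefree_upto n d)"
  proof (rule inj_onI, rule poly_mapping_eqI)
    fix m m' i
    assume *: "m \<in> squarefree_upto n d" "m' \<in> squarefree_upto n d" "keys m = keys m'"
    have "lookup m i \<le> 1" "lookup m' i \<le> 1"
      using * by (auto simp: squarefree_upto_def)
    moreover have "lookup m i = 0 \<longleftrightarrow> lookup m' i = 0"
      using *(3) by (metis in_keys_iff)
    ultimately show "lookup m i = lookup m' i"
      by linarith
  qed
  have "keys ` squarefree_upto n d \<subseteq> {S. S \<subseteq> {1..n} \<and> card S \<le> d}"
    using keys_monomials_upto by (auto simp: squarefree_upto_def)
  from card_inj_on_le[OF inj this finite_small_subsets]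
  show "card (squarefree_upto n d) \<le> binomial_upto n d"
    by (simp only: card_small_subsets)
  show "finite (squarefree_upto n d)"
    using card_monomials_upto(1)[of n d] by (rule finite_subset[rotated]) (simp add: squarefree_upto_def Collect_mono_iff subset_eq)
qed

subsection \<open>Factor products\<close>

text \<open>Turns scaling into ring multiplication, so that identities with real coefficients follow
  from the ring laws.\<close>

lemma Const_mult: "Const c * p = c *\<^sub>R p"
  by (rule poly_mapping_eqI)
     (simp add: Const_def mult_map_scale_conv_mult[symmetric] Poly_Mapping.map.rep_eq when_def)

lemma mult_scaleR_mpoly:
  "p * (c *\<^sub>R q) = c *\<^sub>R (p * q)" "(c *\<^sub>R p) * q = c *\<^sub>R (p * (q :: mpoly))"
  by (simp_all add: Const_mult[symmetric] ac_simps)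

section \<open>Closure properties of the polynomial ring in \<open>n\<close> variables\<close>

lemma poly_ring_mult: "p \<in> poly_ring n \<Longrightarrow> q \<in> poly_ring n \<Longrightarrow> p * q \<in> poly_ring n"
proof -
  assume pq: "p \<in> poly_ring n" "q \<in> poly_ring n"
  have "m \<in> expos n" if m: "m \<in> keys (p * q)" for m
  proof -
    obtain k l where "m = k + l" "k \<in> expos n" "l \<in> expos n"
      using subsetD[OF keys_mult m] pq unfolding poly_ring_def by blast
    then show ?thesis
      using keys_add[of k l] by (auto simp: expos_def)
  qed
  then show ?thesis
    by (auto simp: poly_ring_def)
qed

lemma poly_ring_uminus: "p \<in> poly_ring n \<Longrightarrow> - p \<in> poly_ring n"
  by (simp add: poly_ring_def keys_def)

lemma poly_ring_add: "p \<in> poly_ring n \<Longrightarrow> q \<in> poly_ring n \<Longrightarrow> p + q \<in> poly_ring n"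
  using keys_add[of p q] by (auto simp: poly_ring_def)

lemma poly_ring_diff: "p \<in> poly_ring n \<Longrightarrow> q \<in> poly_ring n \<Longrightarrow> p - q \<in> poly_ring n"
  using poly_ring_add[of p n "- q"] poly_ring_uminus[of q n] by simp

lemma poly_ring_sum:
  "(\<And>i. i \<in> A \<Longrightarrow> p i \<in> poly_ring n) \<Longrightarrow> (\<Sum>i\<in>A. p i) \<in> poly_ring n"
  by (induction A rule: infinite_finite_induct) (auto simp: poly_ring_add, auto simp: poly_ring_def)

lemma poly_ring_single: "m \<in> expos n \<Longrightarrow> Poly_Mapping.single m c \<in> poly_ring n"
  by (simp add: poly_ring_def)

lemma poly_ring_Const: "Const c \<in> poly_ring n"
  unfolding Const_def by (rule poly_ring_single) (simp add: expos_def)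

lemma poly_ring_one: "1 \<in> poly_ring n"
  by (simp add: poly_ring_def expos_def)

lemma poly_ring_Var: "j \<in> {1..n} \<Longrightarrow> Var j \<in> poly_ring n"
  unfolding Var_def by (rule poly_ring_single) (simp add: expos_def)

lemma nonneg_circuit_poly_ring: "nonneg_circuit n q \<Longrightarrow> q \<in> poly_ring n"
  unfolding nonneg_circuit_def monomial_square_def circuit_poly_def
  by (auto intro!: poly_ring_add poly_ring_sum poly_ring_single)

lemma nonneg_circuit_one: "nonneg_circuit n 1"
  unfolding nonneg_circuit_def monomial_square_def
  by (intro disjI1 exI[of _ 0] exI[of _ 1]) (simp add: expos_def even_expo_def)

section \<open>Degree bounds for the basic factors\<close>

lemma total_degree_single: "total_degree (Poly_Mapping.single m c) \<le> expo_degree m"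
  by (rule total_degree_leI) (simp split: if_splits)

lemma total_degree_Const [simp]: "total_degree (Const c) = 0"
  using total_degree_single[of 0 c] by (simp add: Const_def)

lemma total_degree_uminus [simp]: "total_degree (- p) = total_degree p"
  by (simp add: total_degree_def keys_def)

lemma total_degree_diff_le: "total_degree (p - q) \<le> max (total_degree p) (total_degree q)"
proof (rule total_degree_leI)
  fix m assume "m \<in> keys (p - q)"
  then have "m \<in> keys p \<union> keys q"
    by (auto simp: in_keys_iff lookup_minus)
  then show "expo_degree m \<le> max (total_degree p) (total_degree q)"
    using expo_degree_le_total_degree[of m p] expo_degree_le_total_degree[of m q] by auto
qed

lemma total_degree_Var: "total_degree (Var j) \<le> 1"
  unfolding Var_def by (rule order_trans[OF total_degree_single]) simp

lemma total_degree_linear: "total_degree (Var j - Const c) \<le> 1"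
  using total_degree_diff_le[of "Var j" "Const c"] total_degree_Var[of j] by simp

lemma total_degree_cube_poly: "total_degree (cube_poly a b j) \<le> 2"
  unfolding cube_poly_def
  using total_degree_mult_le[of "Var j - Const (a j)" "Var j - Const (b j)"]
    total_degree_linear[of j "a j"] total_degree_linear[of j "b j"] by linarith

section \<open>Products with a prescribed number of factors\<close>

lemma factor_products_mult:
  assumes "g \<in> certificate_factors n a b P" "H \<in> factor_products n a b P q"
  shows "g * H \<in> factor_products n a b P (Suc q)"
proof -
  obtain hs where "H = prod_list hs" "length hs = q" "set hs \<subseteq> certificate_factors n a b P"
    using assms(2) by (auto simp: factor_products_def)
  then show ?thesis
    unfolding factor_products_def using assms(1) by (intro CollectI exI[of _ "g # hs"]) auto
qed

lemma one_certificate_factor: "1 \<in> certificate_factors n a b P"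
  by (simp add: certificate_factors_def)

text \<open>Padding with the factor \<open>1\<close> lets all terms of a certificate share one
  number of factors.\<close>

lemma factor_products_mono:
  assumes "q \<le> q'"
  shows "factor_products n a b P q \<subseteq> factor_products n a b P q'"
  using assms factor_products_mult[OF one_certificate_factor, of _ n a b P]
  by (induction rule: dec_induct) auto

lemma one_factor_product: "1 \<in> factor_products n a b P q"
proof -
  have "1 \<in> factor_products n a b P 0"
    by (simp add: factor_products_def)
  then show ?thesis
    using factor_products_mono[of 0 q] by blast
qed

lemma factor_products_poly_ring:
  assumes "P \<subseteq> poly_ring n" "H \<in> factor_products n a b P q"
  shows "H \<in> poly_ring n"
proof -
  have "certificate_factors n a b P \<subseteq> poly_ring n"
    using assms(1) unfolding certificate_factors_def cube_poly_def
    by (auto intro!: poly_ring_mult poly_ring_diff poly_ring_uminus poly_ring_Var poly_ring_Const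
        poly_ring_one)
  moreover have "prod_list hs \<in> poly_ring n" if "set hs \<subseteq> poly_ring n" for hs
    using that by (induction hs) (auto intro: poly_ring_one poly_ring_mult)
  ultimately show ?thesis
    using assms(2) by (auto simp: factor_products_def)
qed

subsection \<open>Reduction to squarefree monomials\<close>

text \<open>One bound \<open>d\<close> serves for the degree and for the number of factors: a
  further linear factor raises the first by at most one and the second by one, and missing factors
  are filled up with \<open>1\<close>.\<close>

definition bounded_products ::
  "nat \<Rightarrow> (nat \<Rightarrow> real) \<Rightarrow> (nat \<Rightarrow> real) \<Rightarrow> mpoly set \<Rightarrow> nat \<Rightarrow> mpoly set" where
  "bounded_products n a b P d = {H \<in> factor_products n a b P d. total_degree H \<le> d}"

text \<open>The polynomials that, with either sign, are certified by the circuit polynomial \<open>1\<close> alone.\<close>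

definition null_part ::
  "nat \<Rightarrow> (nat \<Rightarrow> real) \<Rightarrow> (nat \<Rightarrow> real) \<Rightarrow> mpoly set \<Rightarrow> nat \<Rightarrow> mpoly set" where
  "null_part n a b P d = {p. p \<in> convex_cone hull bounded_products n a b P d \<and>
     - p \<in> convex_cone hull bounded_products n a b P d}"

text \<open>This is the lineality space of a convex cone; a negative scalar exchanges the roles of
  \<open>p\<close> and \<open>- p\<close>.\<close>

lemma subspace_null_part: "subspace (null_part n a b P d)"
proof (rule subspaceI)
  show "0 \<in> null_part n a b P d"
    by (simp add: null_part_def convex_cone_hull_contains_0)
next
  fix x y assume "x \<in> null_part n a b P d" "y \<in> null_part n a b P d"
  then show "x + y \<in> null_part n a b P d"
    unfolding null_part_def by (simp only: mem_Collect_eq minus_add_distrib) (blast intro: convex_cone_hull_add)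
next
  fix c x assume x: "x \<in> null_part n a b P d"
  show "c *\<^sub>R x \<in> null_part n a b P d"
  proof (cases "c \<ge> 0")
    case True
    then show ?thesis
      using x convex_cone_hull_mul[of "- x" _ c] by (auto simp: null_part_def intro: convex_cone_hull_mul)
  next
    case False
    then show ?thesis
      using x convex_cone_hull_mul[of "- x" _ "- c"] convex_cone_hull_mul[of x _ "- c"]
      by (auto simp: null_part_def)
  qed
qed

lemma null_part_mono: "d \<le> d' \<Longrightarrow> null_part n a b P d \<subseteq> null_part n a b P d'"
proof -
  assume "d \<le> d'"
  then have "bounded_products n a b P d \<subseteq> bounded_products n a b P d'"
    using factor_products_mono[of d d' n a b P] by (auto simp: bounded_products_def)
  then show ?thesis
    using hull_mono[of _ _ convex_cone] unfolding null_part_def by blast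
qed

text \<open>The factor is multiplied into every generator of a conic combination, for
  \<open>p\<close> and for \<open>- p\<close> separately.\<close>

lemma null_part_linear_mult:
  assumes j: "j \<in> {1..n}" and p: "p \<in> null_part n a b P d"
  shows "(Var j - Const (a j)) * p \<in> null_part n a b P (Suc d)"
proof -
  let ?g = "Var j - Const (a j)"
  have *: "?g * p \<in> convex_cone hull bounded_products n a b P (Suc d)"
    if p: "p \<in> convex_cone hull bounded_products n a b P d" for p
  proof -
    obtain F u where F: "finite F" "F \<subseteq> bounded_products n a b P d"
        "\<And>v. v \<in> F \<Longrightarrow> u v \<ge> (0::real)" "p = (\<Sum>v\<in>F. u v *\<^sub>R v)"
      by (rule convex_cone_hull_finite_sum[OF p]) blast
    have "?g * v \<in> bounded_products n a b P (Suc d)" if "v \<in> bounded_products n a b P d" for v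
    proof -
      have "?g \<in> certificate_factors n a b P"
        using j by (auto simp: certificate_factors_def)
      then show ?thesis
        using that total_degree_mult_le[of ?g v] total_degree_linear[of j "a j"]
          factor_products_mult[of ?g n a b P v d] by (simp add: bounded_products_def)
    qed
    then have "(\<Sum>v\<in>F. u v *\<^sub>R (?g * v)) \<in> convex_cone hull bounded_products n a b P (Suc d)"
      using F by (intro convex_cone_hull_sum) (auto intro: hull_inc)
    then show ?thesis
      by (simp only: F(4) sum_distrib_left mult_scaleR_mpoly)
  qed
  from *[of p] *[of "- p"] show ?thesis
    using p by (simp add: null_part_def)
qed

text \<open>The variable is the factor \<open>x_j - a_j\<close> plus the constant
  \<open>a_j\<close>, which may have either sign because \<open>null_part\<close> is a
  subspace.\<close>

lemma null_part_Var_mult: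
  assumes j: "j \<in> {1..n}" and p: "p \<in> null_part n a b P d"
  shows "Var j * p \<in> null_part n a b P (Suc d)"
proof -
  have "Var j * p = (Var j - Const (a j)) * p + a j *\<^sub>R p"
    by (simp add: Const_mult[symmetric] algebra_simps)
  moreover have "p \<in> null_part n a b P (Suc d)"
    using p null_part_mono[of d "Suc d" n a b P] by auto
  ultimately show ?thesis
    using null_part_linear_mult[OF j p]
    by (simp add: subspace_add[OF subspace_null_part] subspace_scale[OF subspace_null_part])
qed

text \<open>Both signs of the cube polynomial are factors; a factor \<open>1\<close> is appended to
  reach two factors.\<close>

lemma cube_poly_null_part: "j \<in> {1..n} \<Longrightarrow> cube_poly a b j \<in> null_part n a b P 2"
proof -
  assume j: "j \<in> {1..n}"
  have "g \<in> factor_products n a b P 2" if "g \<in> certificate_factors n a b P" for g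
    using factor_products_mult[OF that one_factor_product[of n a b P 1]] by (simp add: numeral_2_eq_2)
  moreover have "cube_poly a b j \<in> certificate_factors n a b P"
      "- cube_poly a b j \<in> certificate_factors n a b P"
    using j by (auto simp: certificate_factors_def)
  ultimately show ?thesis
    using total_degree_cube_poly[of a b j] by (simp add: null_part_def bounded_products_def hull_inc)
qed

text \<open>The variables of \<open>m\<close> are multiplied in one at a time, each raising the
  bound by one.\<close>

lemma null_part_monomial_mult:
  assumes "m \<in> expos n" "p \<in> null_part n a b P d"
  shows "Poly_Mapping.single m 1 * p \<in> null_part n a b P (d + expo_degree m)"
  using assms(1)
proof (induction "expo_degree m" arbitrary: m)
  case 0
  then have "m = 0"
    using lookup_le_expo_degree[of m] by (intro poly_mapping_eqI) simp
  then show ?case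
    using assms(2) by simp
next
  case (Suc k)
  then have "keys m \<noteq> {}"
    by (auto simp: expo_degree_def)
  then obtain i where i: "i \<in> keys m"
    by blast
  define m' where "m' = m - Poly_Mapping.single i 1"
  have m: "m = Poly_Mapping.single i 1 + m'"
    using i by (intro poly_mapping_eqI) (auto simp: m'_def lookup_add lookup_minus lookup_single when_def in_keys_iff)
  have "keys m' \<subseteq> keys m"
    by (auto simp: m'_def in_keys_iff lookup_minus)
  then have "m' \<in> expos n" "i \<in> {1..n}"
    using Suc.prems i by (auto simp: expos_def)
  moreover have deg: "expo_degree m = Suc (expo_degree m')"
    by (simp add: m expo_degree_add)
  ultimately have "Var i * (Poly_Mapping.single m' 1 * p) \<in> null_part n a b P (Suc (d + expo_degree m'))"
    using Suc.hyps by (intro null_part_Var_mult) auto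
  moreover have "Poly_Mapping.single m 1 = Var i * Poly_Mapping.single m' (1::real)"
    by (simp add: m Var_def mult_single)
  ultimately show ?case
    by (simp add: deg mult.assoc)
qed

text \<open>Rewrites by \<open>x_i^2 = g_i + (a_i + b_i) x_i - a_i b_i\<close>. The multiple of
  \<open>g_i\<close> is null, and the other terms give monomials of smaller degree, to which the
  induction hypothesis applies.\<close>

lemma monomial_reduction:
  assumes "m \<in> monomials_upto n d"
  shows "\<exists>w\<in>span ((\<lambda>m. Poly_Mapping.single m 1) ` squarefree_upto n d).
    Poly_Mapping.single m 1 - w \<in> null_part n a b P d"
  using assms
proof (induction "expo_degree m" arbitrary: m rule: less_induct)
  case less
  let ?V = "span ((\<lambda>m. Poly_Mapping.single m (1::real)) ` squarefree_upto n d)"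
  let ?x = "\<lambda>m. Poly_Mapping.single m (1::real)"
  note null = subspace_null_part[of n a b P d]
  show ?case
  proof (cases "\<forall>i. lookup m i \<le> 1")
    case True
    then have "?x m \<in> ?V"
      using less.prems by (auto simp: squarefree_upto_def intro!: span_base)
    then show ?thesis
      using subspace_0[OF null] by (intro bexI[of _ "?x m"]) auto
  next
    case False
    then obtain i where i: "lookup m i \<ge> 2"
      by (auto simp: not_le Suc_le_eq numeral_2_eq_2)
    define m' where "m' = m - Poly_Mapping.single i 2"
    have m: "m = m' + Poly_Mapping.single i 2"
      using i by (intro poly_mapping_eqI) (auto simp: m'_def lookup_add lookup_minus lookup_single when_def)
    define m1 where "m1 = m' + Poly_Mapping.single i 1"
    have deg: "expo_degree m = expo_degree m' + 2" "expo_degree m1 = expo_degree m' + 1"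
      by (simp_all add: m m1_def expo_degree_add)
    have "i \<in> keys m" "keys m' \<subseteq> keys m"
      using i by (auto simp: m'_def in_keys_iff lookup_minus)
    then have expos: "m' \<in> expos n" "m1 \<in> expos n" and in_n: "i \<in> {1..n}"
      using less.prems keys_add[of m' "Poly_Mapping.single i 1"]
      by (auto simp: monomials_upto_def expos_def m1_def split: if_splits)
    have "m' \<in> monomials_upto n d" "m1 \<in> monomials_upto n d"
      using expos deg less.prems by (auto simp: monomials_upto_def)
    then obtain w' w1 where w: "w' \<in> ?V" "?x m' - w' \<in> null_part n a b P d"
        "w1 \<in> ?V" "?x m1 - w1 \<in> null_part n a b P d"
      using less.hyps[of m'] less.hyps[of m1] deg by auto
    \<comment> \<open>The coefficients come from expanding \<open>g_i\<close>; \<open>w1\<close> and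
      \<open>w'\<close> replace the monomials with one and two factors \<open>x_i\<close>
      fewer.\<close>
    define w where "w = (a i + b i) *\<^sub>R w1 - (a i * b i) *\<^sub>R w'"
    have "w \<in> ?V"
      unfolding w_def by (intro span_diff span_scale w)
    have "Poly_Mapping.single i (2::nat) = Poly_Mapping.single i 1 + Poly_Mapping.single i 1"
      by (simp add: numeral_2_eq_2 flip: single_add)
    then have "?x m = ?x m' * (Var i * Var i)" "?x m1 = ?x m' * Var i"
      by (simp_all add: m m1_def Var_def mult_single)
    moreover have "X * ((V - Const s) * (V - Const t)) =
        X * (V * V) - (s + t) *\<^sub>R (X * V) + (s * t) *\<^sub>R X" for X V s t
    proof -
      have "Const (s + t) = Const s + Const t" "Const (s * t) = Const s * Const t"
        by (simp_all add: Const_def single_add mult_single)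
      then show ?thesis
        unfolding Const_mult[symmetric] by (simp only:) (simp add: algebra_simps)
    qed
    ultimately have "?x m - w = ?x m' * cube_poly a b i +
        ((a i + b i) *\<^sub>R (?x m1 - w1) - (a i * b i) *\<^sub>R (?x m' - w'))"
      by (simp add: w_def cube_poly_def scaleR_diff_right)
    \<comment> \<open>The product stays within the bound because \<open>|m'| + 2 = |m|\<close>,
      which is at most \<open>d\<close>.\<close>
    moreover have "?x m' * cube_poly a b i \<in> null_part n a b P d"
    proof -
      have "2 + expo_degree m' \<le> d"
        using deg less.prems by (auto simp: monomials_upto_def)
      then show ?thesis
        using null_part_monomial_mult[OF expos(1) cube_poly_null_part[OF in_n]] null_part_mono by blast
    qed
    ultimately have "?x m - w \<in> null_part n a b P d"
      using w by (simp add: subspace_add[OF null] subspace_diff[OF null] subspace_scale[OF null])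
    then show ?thesis
      using \<open>w \<in> ?V\<close> by blast
  qed
qed

lemma mpoly_eq_sum_monomials: "p = (\<Sum>m\<in>keys p. lookup p m *\<^sub>R Poly_Mapping.single m 1)"
proof (rule poly_mapping_eqI)
  fix k
  have "lookup (\<Sum>m\<in>keys p. lookup p m *\<^sub>R Poly_Mapping.single m 1) k =
      (\<Sum>m\<in>keys p. if m = k then lookup p m else 0)"
    by (simp add: lookup_sum lookup_single when_def if_distrib cong: if_cong)
  also have "\<dots> = lookup p k"
    by (simp add: in_keys_iff)
  finally show "lookup p k = lookup (\<Sum>m\<in>keys p. lookup p m *\<^sub>R Poly_Mapping.single m 1) k"
    by simp
qed

lemma poly_ring_span_monomials:
  assumes "p \<in> poly_ring n" "total_degree p \<le> d"
  shows "p \<in> span ((\<lambda>m. Poly_Mapping.single m 1) ` monomials_upto n d)"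
proof -
  have "m \<in> monomials_upto n d" if "m \<in> keys p" for m
    using that assms expo_degree_le_total_degree[OF that]
    by (auto simp: monomials_upto_def poly_ring_def)
  then show ?thesis
    by (subst mpoly_eq_sum_monomials) (intro span_sum span_scale span_base imageI)
qed

text \<open>The sum of the squarefree span and the null part is a subspace, and by
  \<open>monomial_reduction\<close> it contains all monomials of degree at most
  \<open>d\<close>.\<close>

lemma multilinear_reduction:
  assumes "p \<in> poly_ring n" "total_degree p \<le> d"
  obtains w where "w \<in> span ((\<lambda>m. Poly_Mapping.single m 1) ` squarefree_upto n d)"
    "p - w \<in> null_part n a b P d"
proof -
  let ?V = "span ((\<lambda>m. Poly_Mapping.single m (1::real)) ` squarefree_upto n d)"
  let ?T = "{x + y | x y. x \<in> ?V \<and> y \<in> null_part n a b P d}"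
  have "subspace ?T"
    by (rule subspace_sums[OF subspace_span subspace_null_part])
  moreover have "(\<lambda>m. Poly_Mapping.single m 1) ` monomials_upto n d \<subseteq> ?T"
  proof (intro image_subsetI)
    fix m assume "m \<in> monomials_upto n d"
    then obtain w where "w \<in> ?V" "Poly_Mapping.single m 1 - w \<in> null_part n a b P d"
      using monomial_reduction by blast
    then show "Poly_Mapping.single m 1 \<in> ?T"
      by (intro CollectI exI[of _ w] exI[of _ "Poly_Mapping.single m 1 - w"]) simp
  qed
  ultimately have "p \<in> ?T"
    using poly_ring_span_monomials[OF assms] span_minimal by blast
  then show thesis
    using that by auto
qed

subsection \<open>Short certificates\<close>

text \<open>The cone generators use single circuits instead of whole SONC polynomials, so that
  selecting few generators also selects few circuits.\<close>

definition circuit_products ::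
  "nat \<Rightarrow> (nat \<Rightarrow> real) \<Rightarrow> (nat \<Rightarrow> real) \<Rightarrow> mpoly set \<Rightarrow> nat \<Rightarrow> nat \<Rightarrow> mpoly set" where
  "circuit_products n a b P d q = {p * H | p H.
     nonneg_circuit n p \<and> H \<in> factor_products n a b P q \<and> total_degree (p * H) \<le> d}"

lemma circuit_products_poly_ring:
  assumes "P \<subseteq> poly_ring n" "v \<in> circuit_products n a b P d q"
  shows "v \<in> poly_ring n" "total_degree v \<le> d"
  using assms unfolding circuit_products_def
  by (blast intro: poly_ring_mult nonneg_circuit_poly_ring factor_products_poly_ring, blast)

lemma total_degree_scaleR_le: "total_degree (c *\<^sub>R p) \<le> total_degree (p :: mpoly)"
  by (rule total_degree_leI) (auto simp: in_keys_iff intro: expo_degree_le_total_degree)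

text \<open>Splitting \<open>s\<close> into circuits keeps every product within the degree bound by
  \<open>total_degree_circuit_mult_le\<close>.\<close>

lemma sonc_mult_in_circuit_cone:
  assumes "sonc n s" and H: "H \<in> factor_products n a b P q" and deg: "total_degree (s * H) \<le> d"
  shows "s * H \<in> convex_cone hull circuit_products n a b P d q"
proof (cases "H = 0")
  case False
  obtain ws where ws: "\<forall>(\<mu>, p)\<in>set ws. \<mu> \<ge> 0 \<and> nonneg_circuit n p"
      "s = (\<Sum>(\<mu>, p)\<leftarrow>ws. \<mu> *\<^sub>R p)"
    using assms(1) by (auto simp: sonc_def sonc_decomp_def)
  define \<mu> where "\<mu> = (\<lambda>i. fst (ws ! i))"
  define p where "p = (\<lambda>i. snd (ws ! i))"
  \<comment> \<open>Terms of weight zero are left out: their circuits may have arbitrarily large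
    degree.\<close>
  define A where "A = {i \<in> {0..<length ws}. \<mu> i > 0}"
  have nth: "\<mu> i \<ge> 0" "nonneg_circuit n (p i)" if "i < length ws" for i
    using bspec[OF ws(1) nth_mem[OF that]] by (simp_all add: \<mu>_def p_def case_prod_beta)
  have "s = (\<Sum>i\<in>{0..<length ws}. \<mu> i *\<^sub>R p i)"
    by (simp add: ws(2) sum_list_sum_nth \<mu>_def p_def case_prod_beta)
  also have "\<dots> = (\<Sum>i\<in>A. \<mu> i *\<^sub>R p i)"
    using nth by (intro sum.mono_neutral_right) (force simp: A_def)+
  finally have s: "s = (\<Sum>i\<in>A. \<mu> i *\<^sub>R p i)" .
  have A: "finite A" "\<And>i. i \<in> A \<Longrightarrow> \<mu> i > 0" "\<And>i. i \<in> A \<Longrightarrow> nonneg_circuit n (p i)"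
    using nth by (auto simp: A_def)
  have "p i * H \<in> circuit_products n a b P d q" if "i \<in> A" for i
  proof -
    have "total_degree (p i * H) \<le> d"
      using total_degree_circuit_mult_le[of A \<mu> n p H i, OF A False that] deg s by simp
    then show ?thesis
      unfolding circuit_products_def using A(3)[OF that] H by blast
  qed
  then have "(\<Sum>i\<in>A. \<mu> i *\<^sub>R (p i * H)) \<in> convex_cone hull circuit_products n a b P d q"
    using A(2) by (intro convex_cone_hull_sum) (simp add: hull_inc less_imp_le)
  then show ?thesis
    by (simp only: s sum_distrib_right mult_scaleR_mpoly)
qed (simp add: convex_cone_hull_contains_0)

lemma certificate_in_circuit_cone:
  assumes "sonc_certificate n a b P d f L"
  obtains q where "f \<in> convex_cone hull circuit_products n a b P d q"
proof -
  obtain q where q: "\<forall>(s, H)\<in>set L. sonc n s \<and> H \<in> factor_products n a b P q"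
    and f: "f = (\<Sum>(s, H)\<leftarrow>L. s * H)" and deg: "\<forall>(s, H)\<in>set L. total_degree (s * H) \<le> d"
    using assms by (auto simp: sonc_certificate_def)
  have "(\<Sum>(s, H)\<leftarrow>L. s * H) \<in> convex_cone hull circuit_products n a b P d q"
    using q deg
    by (induction L)
       (auto simp: convex_cone_hull_contains_0 intro!: convex_cone_hull_add sonc_mult_in_circuit_cone)
  then show thesis
    using that f by blast
qed

text \<open>Caratheodory is applied to the squarefree reductions of the products, which live in a
  space of dimension at most \<open>binomial_upto n d\<close>. The selected products represent
  \<open>f\<close> up to a null polynomial, which costs only the additional circuit
  \<open>1\<close>.\<close>

lemma few_circuits:
  assumes P: "P \<subseteq> poly_ring n" and f: "f \<in> convex_cone hull circuit_products n a b P d q"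
  obtains Q q' where "1 \<le> q'" "finite Q" "card Q \<le> binomial_upto n d + 1"
    "\<And>p. p \<in> Q \<Longrightarrow> nonneg_circuit n p"
    "f \<in> convex_cone hull {p * H | p H. p \<in> Q \<and> H \<in> factor_products n a b P q' \<and>
       total_degree (p * H) \<le> d}"
proof -
  let ?mono = "\<lambda>m. Poly_Mapping.single m (1::real)"
  let ?B = "?mono ` squarefree_upto n d"
  obtain F u where F: "finite F" "F \<subseteq> circuit_products n a b P d q"
      "\<And>v. v \<in> F \<Longrightarrow> u v \<ge> (0::real)" and f_sum: "f = (\<Sum>v\<in>F. u v *\<^sub>R v)"
    by (rule convex_cone_hull_finite_sum[OF f]) blast
  have "\<exists>w. w \<in> span ?B \<and> v - w \<in> null_part n a b P d" if "v \<in> F" for v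
    using multilinear_reduction[of v n d] circuit_products_poly_ring[OF P] that F(2) by (metis subsetD)
  then obtain w where w: "\<And>v. v \<in> F \<Longrightarrow> w v \<in> span ?B"
      "\<And>v. v \<in> F \<Longrightarrow> v - w v \<in> null_part n a b P d"
    by metis
  have finB: "finite ?B"
    by (intro finite_imageI card_squarefree_upto)
  \<comment> \<open>The reductions are combined, but the index set consists of the products
    \<open>v\<close> themselves.\<close>
  obtain A c where A: "A \<subseteq> F" "card A \<le> card ?B" "\<And>v. v \<in> A \<Longrightarrow> c v > (0::real)"
      "(\<Sum>v\<in>A. c v *\<^sub>R w v) = (\<Sum>v\<in>F. u v *\<^sub>R w v)"
    by (rule conic_caratheodory[OF F(1) finB, of w u]) (use w F(3) in auto)
  have "card ?B \<le> binomial_upto n d"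
    using card_image_le[OF card_squarefree_upto(1), of ?mono n d] card_squarefree_upto(2)[of n d]
    by linarith
  then have card_A: "card A \<le> binomial_upto n d"
    using A(2) by linarith
  \<comment> \<open>The squarefree parts cancel by the choice of \<open>c\<close>, so the error is a
    combination of the null differences \<open>v - w v\<close>.\<close>
  define e where "e = f - (\<Sum>v\<in>A. c v *\<^sub>R v)"
  have "e = (\<Sum>v\<in>F. u v *\<^sub>R (v - w v)) - (\<Sum>v\<in>A. c v *\<^sub>R (v - w v))"
    by (simp add: e_def f_sum scaleR_diff_right sum_subtractf A(4))
  also have "\<dots> \<in> null_part n a b P d"
    using w(2) A(1)
    by (intro subspace_diff[OF subspace_null_part _ _, OF subspace_sum subspace_sum]
        subspace_scale[OF subspace_null_part] subspace_null_part) (blast+)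
  finally have e: "e \<in> convex_cone hull bounded_products n a b P d"
    by (simp add: null_part_def)
  have "\<exists>p H. v = p * H \<and> nonneg_circuit n p \<and> H \<in> factor_products n a b P q \<and>
      total_degree (p * H) \<le> d" if "v \<in> A" for v
    using that A(1) F(2) unfolding circuit_products_def by blast
  then obtain p H where pH: "\<And>v. v \<in> A \<Longrightarrow> v = p v * H v \<and> nonneg_circuit n (p v) \<and>
      H v \<in> factor_products n a b P q \<and> total_degree (p v * H v) \<le> d"
    by metis
  define Q where "Q = insert 1 (p ` A)"
  \<comment> \<open>Large enough for the selected products and for the certificate of
    \<open>e\<close>; \<open>Suc\<close> makes it positive.\<close>
  define q' where "q' = Suc (max q d)"
  define G where "G = {p * H | p H. p \<in> Q \<and> H \<in> factor_products n a b P q' \<and> total_degree (p * H) \<le> d}"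
  have q': "factor_products n a b P q \<subseteq> factor_products n a b P q'"
      "factor_products n a b P d \<subseteq> factor_products n a b P q'"
    by (intro factor_products_mono; simp add: q'_def)+
  have finA: "finite A"
    using A(1) F(1) finite_subset by blast
  have "v \<in> G" if v: "v \<in> A" for v
  proof -
    have "p v \<in> Q" "H v \<in> factor_products n a b P q'" "total_degree (p v * H v) \<le> d" "v = p v * H v"
      using pH[OF v] q' v by (auto simp: Q_def)
    then show ?thesis
      unfolding G_def by blast
  qed
  then have "(\<Sum>v\<in>A. c v *\<^sub>R v) \<in> convex_cone hull G"
    using A(3) by (intro convex_cone_hull_sum) (simp add: hull_inc less_imp_le)
  moreover have "bounded_products n a b P d \<subseteq> G"
  proof
    fix h assume "h \<in> bounded_products n a b P d"
    then have "h = 1 * h" "h \<in> factor_products n a b P q'" "total_degree (1 * h) \<le> d"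
      using q' by (auto simp: bounded_products_def)
    then show "h \<in> G"
      unfolding G_def Q_def by blast
  qed
  then have "e \<in> convex_cone hull G"
    using e hull_mono by blast
  ultimately have "f \<in> convex_cone hull G"
    using convex_cone_hull_add[of "\<Sum>v\<in>A. c v *\<^sub>R v" G e] by (simp add: e_def)
  moreover have "card Q \<le> binomial_upto n d + 1"
    using card_insert_le_m1 card_image_le[OF finA, of p] card_A
    unfolding Q_def by (simp add: card_insert_if finA)
  moreover have "nonneg_circuit n r" if "r \<in> Q" for r
    using that pH nonneg_circuit_one by (auto simp: Q_def)
  ultimately show thesis
    using finA by (intro that[of q' Q]) (auto simp: Q_def q'_def G_def)
qed

text \<open>\<open>few_circuits\<close> bounds the distinct circuits but not the number of terms.
  Caratheodory on the unreduced products, in the space of all polynomials of degree at most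
  \<open>d\<close>, shortens the sum while using only circuits from \<open>Q\<close>.\<close>

lemma short_certificate:
  assumes P: "P \<subseteq> poly_ring n" and "1 \<le> q" and Q: "finite Q" "\<And>p. p \<in> Q \<Longrightarrow> nonneg_circuit n p"
    and f: "f \<in> convex_cone hull {p * H | p H. p \<in> Q \<and> H \<in> factor_products n a b P q \<and>
       total_degree (p * H) \<le> d}" (is "f \<in> convex_cone hull ?G")
  obtains L W where "sonc_certificate n a b P d f L" "circuit_decomp n L W"
    "card (circuits W) \<le> card Q" "circuit_occurrences W \<le> card (monomials_upto n d)"
proof -
  let ?B = "(\<lambda>m. Poly_Mapping.single m (1::real)) ` monomials_upto n d"
  obtain F u where F: "finite F" "F \<subseteq> ?G"
      "\<And>v. v \<in> F \<Longrightarrow> u v \<ge> (0::real)" "f = (\<Sum>v\<in>F. u v *\<^sub>R v)"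
    by (rule convex_cone_hull_finite_sum[OF f]) blast
  have "v \<in> circuit_products n a b P d q" if "v \<in> F" for v
    using that F(2) Q(2) unfolding circuit_products_def by blast
  then have span: "v \<in> span ?B" if "v \<in> F" for v
    using that circuit_products_poly_ring[OF P] poly_ring_span_monomials by blast
  have finB: "finite ?B"
    by (intro finite_imageI card_monomials_upto)
  obtain A c where A: "A \<subseteq> F" "card A \<le> card ?B" "\<And>v. v \<in> A \<Longrightarrow> c v > (0::real)"
      "(\<Sum>v\<in>A. c v *\<^sub>R v) = (\<Sum>v\<in>F. u v *\<^sub>R v)"
    by (rule conic_caratheodory[OF F(1) finB, of "\<lambda>v. v" u]) (use span F(3) in auto)
  have "card ?B \<le> card (monomials_upto n d)"
    by (intro card_image_le card_monomials_upto)
  then have card_A: "card A \<le> card (monomials_upto n d)"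
    using A(2) by linarith
  have "\<exists>p H. v = p * H \<and> p \<in> Q \<and> H \<in> factor_products n a b P q \<and> total_degree (p * H) \<le> d"
    if "v \<in> A" for v
    using that A(1) F(2) by blast
  then obtain p H where pH: "\<And>v. v \<in> A \<Longrightarrow> v = p v * H v \<and> p v \<in> Q \<and>
      H v \<in> factor_products n a b P q \<and> total_degree (p v * H v) \<le> d"
    by metis
  have "finite A"
    using A(1) F(1) finite_subset by blast
  then obtain vs where vs: "set vs = A" "distinct vs"
    using finite_distinct_list by blast
  \<comment> \<open>Each term holds one circuit, with its weight absorbed into the SONC factor, so
    occurrences are counted by the length of \<open>vs\<close>.\<close>
  define L where "L = map (\<lambda>v. (c v *\<^sub>R p v, H v)) vs"
  define W where "W = map (\<lambda>v. [(c v, p v)]) vs"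
  have decomp: "sonc_decomp n (c v *\<^sub>R p v) [(c v, p v)]" if "v \<in> A" for v
    using pH[OF that] A(3)[OF that] Q(2) by (simp add: sonc_decomp_def less_imp_le)
  have "f = (\<Sum>v\<in>A. (c v *\<^sub>R p v) * H v)"
    unfolding F(4) A(4)[symmetric] using pH by (intro sum.cong) (auto simp: mult_scaleR_mpoly)
  then have "f = (\<Sum>(s, H)\<leftarrow>L. s * H)"
    by (simp add: L_def o_def vs(1)[symmetric] sum_list_distinct_conv_sum_set[OF vs(2)])
  moreover have "total_degree ((c v *\<^sub>R p v) * H v) \<le> d" if "v \<in> A" for v
    unfolding mult_scaleR_mpoly using pH[OF that] total_degree_scaleR_le[of "c v" "p v * H v"] by linarith
  moreover have "sonc n (c v *\<^sub>R p v)" if "v \<in> A" for v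
    using decomp[OF that] by (auto simp: sonc_def)
  ultimately have "sonc_certificate n a b P d f L"
    using pH vs(1) \<open>1 \<le> q\<close> by (auto simp: sonc_certificate_def L_def intro!: exI[of _ q])
  moreover have "circuit_decomp n L W"
    using decomp vs(1)
    by (auto simp: circuit_decomp_def L_def W_def list_all2_conv_all_nth)
  moreover have "circuits W \<subseteq> Q"
    using pH vs(1) by (auto simp: circuits_def W_def)
  then have "card (circuits W) \<le> card Q"
    by (rule card_mono[OF Q(1)])
  moreover have "circuit_occurrences W \<le> card (monomials_upto n d)"
    using card_A distinct_card[OF vs(2)] vs(1)
    by (simp add: circuit_occurrences_def W_def o_def sum_list_triv)
  ultimately show thesis
    by (rule that)
qed

theorem theorem4p9:
  fixes pb :: "real poly"
  shows "\<exists>(C :: real) (K :: nat \<Rightarrow> real).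
    \<forall>(n :: nat) (d :: nat) (a :: nat \<Rightarrow> real) (b :: nat \<Rightarrow> real) (P :: mpoly set) (f :: mpoly).
      (\<forall>j\<in>{1..n}. a j < b j) \<longrightarrow>
      finite P \<longrightarrow> P \<subseteq> poly_ring n \<longrightarrow> real (card P) \<le> poly pb (real n) \<longrightarrow>
      f \<in> poly_ring n \<longrightarrow>
      (\<forall>x\<in>constrained_hypercube n a b P. peval f x \<ge> 0) \<longrightarrow>
      (\<exists>L. sonc_certificate n a b P d f L) \<longrightarrow>
      (\<exists>L W. sonc_certificate n a b P d f L \<and> circuit_decomp n L W \<and>
         real (card (circuits W)) \<le> C * real (binomial_upto n d) \<and>
         real (circuit_occurrences W) \<le> K d * real (binomial_upto n d))"
\<comment> \<open>The constant \<open>2\<close> absorbs the extra circuit \<open>1\<close>;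
  \<open>(d + 1) ^ d\<close> is the bound on exponent patterns per support from
  \<open>card_monomials_upto\<close>.\<close>
proof (rule exI[of _ 2], rule exI[of _ "\<lambda>d. real ((d + 1) ^ d)"], intro allI impI)
  fix n d a b P f
  assume P: "P \<subseteq> poly_ring n" and "\<exists>L. sonc_certificate n a b P d f L"
  then obtain q where "f \<in> convex_cone hull circuit_products n a b P d q"
    using certificate_in_circuit_cone by metis
  then obtain Q q' where Q: "1 \<le> q'" "finite Q" "card Q \<le> binomial_upto n d + 1"
      "\<And>p. p \<in> Q \<Longrightarrow> nonneg_circuit n p"
      "f \<in> convex_cone hull {p * H | p H. p \<in> Q \<and> H \<in> factor_products n a b P q' \<and>
         total_degree (p * H) \<le> d}"
    by (rule few_circuits[OF P]) blast
  obtain L W where LW: "sonc_certificate n a b P d f L" "circuit_decomp n L W"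
      "card (circuits W) \<le> card Q" "circuit_occurrences W \<le> card (monomials_upto n d)"
    by (rule short_certificate[OF P Q(1,2,4,5)])
  \<comment> \<open>The summand for \<open>k = 0\<close> shows \<open>binomial_upto n d\<close> to
    be at least 1, so adding one at most doubles it.\<close>
  have "n choose 0 \<le> binomial_upto n d"
    unfolding binomial_upto_def by (intro member_le_sum) auto
  then have "card (circuits W) \<le> 2 * binomial_upto n d"
    using LW(3) Q(3) by simp
  then have "real (card (circuits W)) \<le> 2 * real (binomial_upto n d)"
    by linarith
  moreover have "circuit_occurrences W \<le> (d + 1) ^ d * binomial_upto n d"
    using LW(4) card_monomials_upto(2)[of n d] by linarith
  then have "real (circuit_occurrences W) \<le> real ((d + 1) ^ d) * real (binomial_upto n d)"
    by (metis of_nat_le_iff of_nat_mult)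
  ultimately show "\<exists>L W. sonc_certificate n a b P d f L \<and> circuit_decomp n L W \<and>
      real (card (circuits W)) \<le> 2 * real (binomial_upto n d) \<and>
      real (circuit_occurrences W) \<le> real ((d + 1) ^ d) * real (binomial_upto n d)"
    using LW by blast
qed

end
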